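(* Let $K,P:\mathbb{N}_0\to\mathbb{N}_0$ with $K_n<P_n$ for all $n=1,2,\ldots$, let $\alpha:\mathbb{N}_0\to[0,1]$, and write $\theta_n=(K_n,P_n)$. Suppose that $$\alpha_n\,(1-q(\theta_n))=\frac{\log n+\gamma_n}{n},\qquad n=1,2,\ldots$$ for some function $\gamma:\mathbb{N}_0\to\mathbb{R}$. If $\lim_{n\to\infty}\gamma_n=-\infty$, then $$\lim_{n\to\infty}P_n(\theta_n,\alpha_n)=0$$ provided either (a) $\limsup_{n\to\infty}\alpha_n\log n<\infty$, or (b) $\limsup_{n\to\infty}\alpha_n\log n=\infty$ with $\limsup_{n\to\infty}\alpha_n<1$.
   Context: $\mathbb{N}_0=\{1,2,\ldots\}$ denotes the positive integers. For positive integers $K<P$ write $\theta=(K,P)$ and set $$q(\theta)=0\ \text{ if } P<2K,\qquad q(\theta)=\binom{P-K}{K}\Big/\binom{P}{K}\ \text{ if } 2K\le P.$$ Random graph model: given a number $n$ of nodes, $\theta=(K,P)$ and $\alpha\in[0,1]$, let $K_1(\theta),\ldots,K_n(\theta)$ be i.i.d. random sets, each uniformly distributed over the collection of all $K$-element subsets of $\{1,\ldots,P\}$. Let $B_{ij}(\alpha)$, $1\le i<j\le n$, be i.i.d. $\{0,1\}$-valued random variables with $\mathbb{P}[B_{ij}(\alpha)=1]=\alpha$, independent of the family $K_1(\theta),\ldots,K_n(\theta)$; put $B_{ji}(\alpha)=B_{ij}(\alpha)$. The random graph $\mathbb{K}\cap\mathbb{G}(n;\theta,\alpha)$ is the undirected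 graph on the vertex set $\{1,\ldots,n\}$ in which distinct nodes $i,j$ are adjacent if and only if $K_i(\theta)\cap K_j(\theta)\ne\emptyset$ and $B_{ij}(\alpha)=1$. (It is the intersection of a random key graph and an Erdős–Rényi graph.) $P_n(\theta,\alpha)$ denotes the probability that $\mathbb{K}\cap\mathbb{G}(n;\theta,\alpha)$ contains no isolated nodes. *)

theory Defs
  imports "HOL-Probability.Probability"
begin

definition q :: "nat \<Rightarrow> nat \<Rightarrow> real" where
  "q K P = (if P < 2 * K then 0 else real ((P - K) choose K) / real (P choose K))"

definition key_rings :: "nat \<Rightarrow> nat \<Rightarrow> nat set set" where
  "key_rings K P = {S. S \<subseteq> {1..P} \<and> card S = K}"

text \<open>
  Joint law of the key sets \<open>K\<^sub>1, \<dots>, K\<^sub>n\<close> and of the channel variables \<open>B\<^sub>i\<^sub>j\<close>, \<open>1 \<le> i < j \<le> n\<close>: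
  all of them are independent, the key sets being uniform on the \<open>K\<close>-element subsets
  of \<open>{1..P}\<close> and the channel variables Bernoulli with parameter \<open>\<alpha>\<close>.
  The laws are the intended ones only for \<open>K \<le> P\<close> and \<open>0 \<le> \<alpha> \<le> 1\<close>: outside this range
  \<open>pmf_of_set\<close> is unspecified and \<open>bernoulli_pmf\<close> clips its parameter. The values \<open>{}\<close> and
  \<open>False\<close> are the defaults of \<open>Pi_pmf\<close> outside the index sets.
\<close>

definition key_channel_pmf ::
  "nat \<Rightarrow> nat \<Rightarrow> nat \<Rightarrow> real \<Rightarrow> ((nat \<Rightarrow> nat set) \<times> (nat \<times> nat \<Rightarrow> bool)) pmf" where
  "key_channel_pmf n K P \<alpha> =
     pair_pmf
       (Pi_pmf {1..n} {} (\<lambda>_. pmf_of_set (key_rings K P)))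
       (Pi_pmf {(i, j). 1 \<le> i \<and> i < j \<and> j \<le> n} False (\<lambda>_. bernoulli_pmf \<alpha>))"

text \<open>The use of \<open>min\<close> and \<open>max\<close> implements the convention \<open>B\<^sub>j\<^sub>i = B\<^sub>i\<^sub>j\<close>.\<close>

definition adjacent ::
  "(nat \<Rightarrow> nat set) \<times> (nat \<times> nat \<Rightarrow> bool) \<Rightarrow> nat \<Rightarrow> nat \<Rightarrow> bool" where
  "adjacent \<omega> i j \<longleftrightarrow>
     i \<noteq> j \<and> fst \<omega> i \<inter> fst \<omega> j \<noteq> {} \<and> snd \<omega> (min i j, max i j)"

definition isolated_node ::
  "nat \<Rightarrow> (nat \<Rightarrow> nat set) \<times> (nat \<times> nat \<Rightarrow> bool) \<Rightarrow> nat \<Rightarrow> bool" where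
  "isolated_node n \<omega> i \<longleftrightarrow> i \<in> {1..n} \<and> (\<forall>j\<in>{1..n}. \<not> adjacent \<omega> i j)"

definition prob_no_isolated :: "nat \<Rightarrow> nat \<Rightarrow> nat \<Rightarrow> real \<Rightarrow> real" where
  "prob_no_isolated n K P \<alpha> =
     measure_pmf.prob (key_channel_pmf n K P \<alpha>) {\<omega>. \<not> (\<exists>i. isolated_node n \<omega> i)}"

end

theory Submission
  imports Defs "HOL-Real_Asymp.Real_Asymp"
begin

text \<open>
  The proof is the second moment method applied to the number \<open>X\<close> of isolated nodes. Put
  \<open>p = \<alpha> (1 - q)\<close>, the edge probability. Whatever the key ring of a node is, a further node
  fails to be its neighbour with probability \<open>1 - p\<close>, so a node is isolated with probability
  \<open>a = (1 - p) ^ (n - 1)\<close>. Since \<open>n p = log n + \<gamma>\<close> with \<open>\<gamma> \<longlonglongrightarrow> -\<infinity>\<close>, the mean \<open>n a\<close> is at least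
  \<open>exp (- \<gamma> - 2)\<close> eventually (\<open>inverse_mean_le\<close>) and tends to infinity. It remains to see that
  isolation of two nodes is asymptotically no more likely than under independence.

  Given the rings \<open>S, S'\<close> of two nodes, a third node is adjacent to neither with probability
  \<open>(1 - p)\<^sup>2 + \<alpha>\<^sup>2 (r - q\<^sup>2)\<close>, where \<open>r\<close> is the probability that its ring avoids \<open>S \<union> S'\<close>. If
  \<open>S\<close> and \<open>S'\<close> are disjoint, log-concavity of binomial coefficients gives \<open>r \<le> q\<^sup>2\<close>, so the
  correlation is negative. Otherwise the trivial bound \<open>r \<le> q\<close> loses at most a summand \<open>\<alpha> p\<close>,
  but this happens only with probability \<open>1 - q\<close>. Up to a factor \<open>(1 - p) ^ 2\<close>, the ratio of the
  pair probability to \<open>a\<^sup>2\<close> is therefore at most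
  \<open>1 + (1 - q) ((1 + \<alpha> p / (1 - p)\<^sup>2) ^ (n - 2) - 1)\<close> (\<open>prob_no_isolated_le\<close>).

  The bound \<open>(1 + x) ^ m - 1 \<le> m x exp (m x)\<close> turns the excess into about
  \<open>(1 - q) n \<alpha> p exp (n \<alpha> p)\<close>. Here \<open>(1 - q) \<alpha> = p\<close>, and \<open>n p \<le> log n\<close> eventually, so the excess
  is at most about \<open>(log n)\<^sup>2 / n \<cdot> n powr \<alpha>\<close> (\<open>correlation_term_le\<close>). This tends to \<open>0\<close> as soon as
  \<open>\<alpha>\<close> stays below some \<open>1 - \<delta>\<close>, which each of the two alternatives implies: if \<open>\<alpha> log n\<close> is
  bounded, then even \<open>\<alpha> \<longlonglongrightarrow> 0\<close>.
\<close>

section \<open>Key rings\<close>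

lemma card_key_rings: "card (key_rings K P) = P choose K"
  using n_subsets[of "{1..P}" K] by (simp add: key_rings_def)

lemma finite_key_rings: "finite (key_rings K P)"
  by (rule finite_subset[of _ "Pow {1..P}"]) (auto simp: key_rings_def)

lemma key_rings_nonempty:
  assumes "K \<le> P"
  shows "key_rings K P \<noteq> {}"
proof
  assume "key_rings K P = {}"
  then have "P choose K = 0" using card_key_rings[of K P] by simp
  then show False using assms by simp
qed

lemma set_pmf_key_rings:
  assumes "K \<le> P"
  shows "set_pmf (pmf_of_set (key_rings K P)) = key_rings K P"
  using assms finite_key_rings key_rings_nonempty by simp

lemma prob_key_ring_avoids:
  assumes "K \<le> P" "U \<subseteq> {1..P}"
  shows "measure_pmf.prob (pmf_of_set (key_rings K P)) {T. U \<inter> T = {}} =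
           real ((P - card U) choose K) / real (P choose K)"
proof -
  have "key_rings K P \<inter> {T. U \<inter> T = {}} = {T. T \<subseteq> {1..P} - U \<and> card T = K}"
    by (auto simp: key_rings_def)
  moreover have "card ({1..P} - U) = P - card U"
    using assms(2) by (subst card_Diff_subset) (auto intro: finite_subset)
  ultimately have "card (key_rings K P \<inter> {T. U \<inter> T = {}}) = (P - card U) choose K"
    using n_subsets[of "{1..P} - U" K] by simp
  then show ?thesis
    using assms(1) finite_key_rings key_rings_nonempty card_key_rings
    by (simp add: measure_pmf_of_set)
qed

text \<open>The case distinction in \<^const>\<open>q\<close> disappears because \<open>P < 2 * K\<close> means \<open>P - K < K\<close>, where the
  binomial coefficient vanishes.\<close>

lemma q_eq_binomial_ratio: "q K P = real ((P - K) choose K) / real (P choose K)"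
  by (auto simp: q_def binomial_eq_0)

lemma prob_key_ring_avoids_ring:
  assumes "K \<le> P" "S \<in> key_rings K P"
  shows "measure_pmf.prob (pmf_of_set (key_rings K P)) {T. S \<inter> T = {}} = q K P"
  using assms prob_key_ring_avoids[of K P S] by (auto simp: key_rings_def q_eq_binomial_ratio)

lemma q_nonneg: "0 \<le> q K P"
  by (simp add: q_def)

lemma q_le_1:
  assumes "K \<le> P"
  shows "q K P \<le> 1"
proof -
  obtain S where "S \<in> key_rings K P" using key_rings_nonempty[OF assms] by auto
  from prob_key_ring_avoids_ring[OF assms this] show ?thesis
    by (metis measure_pmf.prob_le_1)
qed

text \<open>Written as a product over \<open>i < k\<close>, the claim holds factor by factor:
  \<open>(x - h) (x + h) \<le> x\<^sup>2\<close> with \<open>x = m + h - i\<close>.\<close>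

lemma binomial_log_concave:
  "real (m choose k) * real ((m + 2 * h) choose k) \<le> (real ((m + h) choose k))\<^sup>2"
proof (cases "k \<le> m")
  case True
  have "real (m choose k) * real ((m + 2 * h) choose k) =
      (\<Prod>i = 0..<k. real (m - i) / real (k - i) * (real (m + 2 * h - i) / real (k - i)))"
    using True by (simp only: binomial_altdef_of_nat prod.distrib trans_le_add1)
  also have "\<dots> \<le> (\<Prod>i = 0..<k. (real (m + h - i) / real (k - i))\<^sup>2)"
  proof (rule prod_mono, intro conjI)
    fix i assume i: "i \<in> {0..<k}"
    have "real (m - i) * real (m + 2 * h - i) \<le> (real (m + h - i))\<^sup>2"
      using i True by (simp add: of_nat_diff power2_eq_square algebra_simps)
    then show "real (m - i) / real (k - i) * (real (m + 2 * h - i) / real (k - i))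
        \<le> (real (m + h - i) / real (k - i))\<^sup>2"
      by (simp add: power_divide power2_eq_square divide_right_mono)
  qed simp
  also have "\<dots> = (real ((m + h) choose k))\<^sup>2"
    using True by (simp add: binomial_altdef_of_nat prod_power_distrib)
  finally show ?thesis .
qed (simp add: binomial_eq_0)

text \<open>Avoiding one ring makes it harder to avoid a disjoint one, since the ring then has to fit
  into fewer keys. This is log-concavity with the spacing \<open>h = K\<close>.\<close>

lemma prob_key_ring_avoids_disjoint_pair:
  assumes "K \<le> P" "S \<in> key_rings K P" "S' \<in> key_rings K P" "S \<inter> S' = {}"
  shows "measure_pmf.prob (pmf_of_set (key_rings K P)) {T. (S \<union> S') \<inter> T = {}} \<le> (q K P)\<^sup>2"
proof -
  have sub: "S \<union> S' \<subseteq> {1..P}" and fin: "finite S" "finite S'"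
    using assms(2,3) by (auto simp: key_rings_def intro: finite_subset)
  have card: "card (S \<union> S') = 2 * K"
    using assms fin by (simp add: card_Un_disjoint key_rings_def)
  have "card (S \<union> S') \<le> P"
    using card_mono[OF _ sub] by simp
  then have le: "2 * K \<le> P" using card by simp
  have pos: "0 < real (P choose K)" using assms(1) by simp
  have eqs: "P - 2 * K + 2 * K = P" "P - 2 * K + K = P - K" using le by auto
  have conc: "real ((P - 2 * K) choose K) * real (P choose K) \<le> (real ((P - K) choose K))\<^sup>2"
    using binomial_log_concave[of "P - 2 * K" K K] unfolding eqs .
  have "measure_pmf.prob (pmf_of_set (key_rings K P)) {T. (S \<union> S') \<inter> T = {}} =
      real ((P - 2 * K) choose K) / real (P choose K)"
    using prob_key_ring_avoids[OF assms(1) sub] card by simp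
  also have "\<dots> \<le> (q K P)\<^sup>2"
    using conc pos by (simp add: q_eq_binomial_ratio power_divide field_simps power2_eq_square)
  finally show ?thesis .
qed

section \<open>Isolation probabilities\<close>

lemma expectation_pair_pmf:
  fixes h :: "'a \<times> 'b \<Rightarrow> real"
  assumes "finite (set_pmf p)" "finite (set_pmf r)"
  shows "measure_pmf.expectation (pair_pmf p r) h =
           measure_pmf.expectation p (\<lambda>a. measure_pmf.expectation r (\<lambda>b. h (a, b)))"
proof -
  have inner: "measure_pmf.expectation (r \<bind> (\<lambda>b. return_pmf (a, b))) h =
      measure_pmf.expectation r (\<lambda>b. h (a, b))" for a
    using assms(2)
    by (subst pmf_expectation_bind[of "set_pmf r"]) (auto simp: integral_measure_pmf[of "set_pmf r"])
  show ?thesis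
    unfolding pair_pmf_def using assms
    by (subst pmf_expectation_bind[of "set_pmf p"])
       (auto simp: inner integral_measure_pmf[of "set_pmf p"])
qed

lemma finite_set_Pi_pmf:
  assumes "finite A" "\<And>x. x \<in> A \<Longrightarrow> finite (set_pmf (p x))"
  shows "finite (set_pmf (Pi_pmf A dflt p))"
  using assms by (simp add: set_Pi_pmf finite_PiE_dflt)

definition channels :: "nat \<Rightarrow> (nat \<times> nat) set" where
  "channels n = {(i, j). 1 \<le> i \<and> i < j \<and> j \<le> n}"

lemma finite_channels: "finite (channels n)"
  by (rule finite_subset[of _ "{1..n} \<times> {1..n}"]) (auto simp: channels_def)

lemma prob_channels_closed:
  assumes "D \<subseteq> channels n" "0 \<le> \<alpha>" "\<alpha> \<le> 1"
  shows "measure_pmf.prob (Pi_pmf (channels n) False (\<lambda>_. bernoulli_pmf \<alpha>)) {b. \<forall>e\<in>D. \<not> b e} =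
           (1 - \<alpha>) ^ card D"
proof -
  let ?B = "\<lambda>e. if e \<in> D then {False} else UNIV"
  have "{b. \<forall>e\<in>D. \<not> b e} = Pi (channels n) ?B"
    using assms(1) by (auto simp: Pi_def split: if_splits)
  then have "measure_pmf.prob (Pi_pmf (channels n) False (\<lambda>_. bernoulli_pmf \<alpha>)) {b. \<forall>e\<in>D. \<not> b e} =
      (\<Prod>e\<in>channels n. measure_pmf.prob (bernoulli_pmf \<alpha>) (?B e))"
    by (simp add: measure_Pi_pmf_Pi finite_channels)
  also have "\<dots> = (\<Prod>e\<in>channels n. if e \<in> D then 1 - \<alpha> else 1)"
    using assms(2,3) by (intro prod.cong) (auto simp: measure_pmf_single)
  also have "\<dots> = (\<Prod>e\<in>D. 1 - \<alpha>)"
    using assms(1) by (simp add: prod.If_cases finite_channels Int_absorb1)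
  finally show ?thesis by simp
qed

text \<open>For a single node, being cut off means being isolated. For a pair of nodes it leaves the edge
  between the two unconstrained: this event is larger than joint isolation, which is harmless for
  an upper bound, and it involves every other node in the same way.\<close>

definition cut_off :: "nat \<Rightarrow> nat set \<Rightarrow> ((nat \<Rightarrow> nat set) \<times> (nat \<times> nat \<Rightarrow> bool)) set" where
  "cut_off n W = {\<omega>. \<forall>i\<in>W. \<forall>j\<in>{1..n} - W. \<not> adjacent \<omega> i j}"

lemma isolated_node_iff_cut_off:
  "isolated_node n \<omega> i \<longleftrightarrow> i \<in> {1..n} \<and> \<omega> \<in> cut_off n {i}"
  by (auto simp: isolated_node_def cut_off_def adjacent_def)

text \<open>With the rings fixed, the channels that must be closed are those between \<open>W\<close> and its complement
  whose end nodes share a key. No channel is counted twice, because an unordered pair determines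
  which of its ends lies in \<open>W\<close>.\<close>

lemma prob_cut_off_given_rings:
  assumes "W \<subseteq> {1..n}" "0 \<le> \<alpha>" "\<alpha> \<le> 1"
  shows "measure_pmf.prob (Pi_pmf (channels n) False (\<lambda>_. bernoulli_pmf \<alpha>)) {b. (f, b) \<in> cut_off n W} =
           (\<Prod>j\<in>{1..n} - W. \<Prod>i\<in>W. if f i \<inter> f j = {} then 1 else 1 - \<alpha>)"
proof -
  define edge :: "nat \<times> nat \<Rightarrow> nat \<times> nat" where "edge = (\<lambda>(j, i). (min i j, max i j))"
  define M where "M = {(j, i). j \<in> {1..n} - W \<and> i \<in> W \<and> f i \<inter> f j \<noteq> {}}"
  have finW: "finite W" using assms(1) by (rule finite_subset) simp
  have Msub: "M \<subseteq> ({1..n} - W) \<times> W" by (auto simp: M_def)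
  have sub: "edge ` M \<subseteq> channels n"
  proof
    fix e assume "e \<in> edge ` M"
    then obtain j i where e: "e = edge (j, i)" and ji: "(j, i) \<in> M" by auto
    have "j \<in> {1..n}" "i \<in> {1..n}" "i \<noteq> j" using ji assms(1) by (auto simp: M_def)
    then show "e \<in> channels n" by (auto simp: e edge_def channels_def)
  qed
  have inj: "inj_on edge M"
    by (auto simp: inj_on_def M_def edge_def min_def max_def split: if_splits)
  have "{b. (f, b) \<in> cut_off n W} = {b. \<forall>e\<in>edge ` M. \<not> b e}"
  proof (intro Collect_cong iffI)
    fix b assume cut: "(f, b) \<in> cut_off n W"
    have "\<not> b (edge (j, i))" if "(j, i) \<in> M" for i j
    proof -
      have *: "j \<in> {1..n} - W" "i \<in> W" "i \<noteq> j" "f i \<inter> f j \<noteq> {}" using that by (auto simp: M_def)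
      then have "\<not> adjacent (f, b) i j" using cut unfolding cut_off_def by blast
      with *(3,4) show ?thesis by (simp add: adjacent_def edge_def)
    qed
    then show "\<forall>e\<in>edge ` M. \<not> b e" by auto
  next
    fix b assume closed: "\<forall>e\<in>edge ` M. \<not> b e"
    have "\<not> adjacent (f, b) i j" if "i \<in> W" "j \<in> {1..n} - W" for i j
    proof (cases "f i \<inter> f j = {}")
      case False
      with that have "(j, i) \<in> M" by (simp add: M_def)
      with closed have "\<not> b (edge (j, i))" by blast
      then show ?thesis by (simp add: adjacent_def edge_def)
    qed (simp add: adjacent_def)
    then show "(f, b) \<in> cut_off n W" by (simp add: cut_off_def)
  qed
  then have "measure_pmf.prob (Pi_pmf (channels n) False (\<lambda>_. bernoulli_pmf \<alpha>)) {b. (f, b) \<in> cut_off n W} =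
      (1 - \<alpha>) ^ card M"
    using prob_channels_closed[OF sub assms(2,3)] by (simp add: card_image inj)
  also have "\<dots> = (\<Prod>x\<in>({1..n} - W) \<times> W. if x \<in> M then 1 - \<alpha> else 1)"
    using finW Msub by (simp add: prod.If_cases Int_absorb1)
  also have "\<dots> = (\<Prod>j\<in>{1..n} - W. \<Prod>i\<in>W. if (j, i) \<in> M then 1 - \<alpha> else 1)"
    by (subst prod.cartesian_product) (simp add: case_prod_beta')
  also have "\<dots> = (\<Prod>j\<in>{1..n} - W. \<Prod>i\<in>W. if f i \<inter> f j = {} then 1 else 1 - \<alpha>)"
    by (intro prod.cong) (auto simp: M_def)
  finally show ?thesis .
qed

text \<open>Given the rings of \<open>W\<close>, the remaining \<open>n - card W\<close> nodes are independent and identically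
  distributed, so integrating out their rings turns the product into a power.\<close>

lemma prob_cut_off:
  assumes "W \<subseteq> {1..n}" "K \<le> P" "0 \<le> \<alpha>" "\<alpha> \<le> 1"
  shows "measure_pmf.prob (key_channel_pmf n K P \<alpha>) (cut_off n W) =
     measure_pmf.expectation (Pi_pmf W {} (\<lambda>_. pmf_of_set (key_rings K P)))
       (\<lambda>g. measure_pmf.expectation (pmf_of_set (key_rings K P))
              (\<lambda>T. \<Prod>i\<in>W. if g i \<inter> T = {} then 1 else 1 - \<alpha>) ^ (n - card W))"
proof -
  let ?R = "pmf_of_set (key_rings K P)"
  let ?B = "Pi_pmf (channels n) False (\<lambda>_. bernoulli_pmf \<alpha>)"
  let ?h = "\<lambda>g T. \<Prod>i\<in>W. if g i \<inter> T = {} then 1 else 1 - \<alpha>"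
  let ?V = "{1..n} - W"
  have finR: "finite (set_pmf ?R)"
    using assms(2) by (simp add: set_pmf_key_rings finite_key_rings)
  have finPi: "finite (set_pmf (Pi_pmf A {} (\<lambda>_. ?R)))" if "finite A" for A :: "nat set"
    using that finR by (intro finite_set_Pi_pmf)
  have finB: "finite (set_pmf ?B)"
    by (intro finite_set_Pi_pmf finite_channels) (rule finite_subset[OF subset_UNIV], simp)
  have finW: "finite W" using assms(1) by (rule finite_subset) simp
  have expectation_cut_off: "measure_pmf.expectation ?B (\<lambda>b. of_bool ((f, b) \<in> cut_off n W)) =
      measure_pmf.prob ?B {b. (f, b) \<in> cut_off n W}" for f
  proof -
    have "measure_pmf.expectation ?B (\<lambda>b. of_bool ((f, b) \<in> cut_off n W)) =
        measure_pmf.expectation ?B (indicator {b. (f, b) \<in> cut_off n W})"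
      by (intro Bochner_Integration.integral_cong) (auto simp: indicator_def)
    also have "\<dots> = measure_pmf.prob ?B {b. (f, b) \<in> cut_off n W}" by simp
    finally show ?thesis .
  qed
  have union: "Pi_pmf {1..n} {} (\<lambda>_. ?R) = map_pmf (\<lambda>(g, f) x. if x \<in> W then g x else f x)
      (pair_pmf (Pi_pmf W {} (\<lambda>_. ?R)) (Pi_pmf ?V {} (\<lambda>_. ?R)))"
    using Pi_pmf_union[of W ?V "{}" "\<lambda>_. ?R"] finW assms(1) by (simp add: Un_absorb1)
  have "measure_pmf.prob (key_channel_pmf n K P \<alpha>) (cut_off n W) =
      measure_pmf.expectation (pair_pmf (Pi_pmf {1..n} {} (\<lambda>_. ?R)) ?B) (indicator (cut_off n W))"
    by (simp add: key_channel_pmf_def channels_def)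
  also have "\<dots> = measure_pmf.expectation (Pi_pmf {1..n} {} (\<lambda>_. ?R))
      (\<lambda>f. measure_pmf.expectation ?B (indicator {b. (f, b) \<in> cut_off n W}))"
    using finPi finB by (subst expectation_pair_pmf) (auto simp: indicator_def[abs_def] simp: expectation_cut_off)
  also have "\<dots> = measure_pmf.expectation (Pi_pmf {1..n} {} (\<lambda>_. ?R))
      (\<lambda>f. \<Prod>j\<in>?V. ?h f (f j))"
    using prob_cut_off_given_rings[OF assms(1,3,4)] by simp
  also have "\<dots> = measure_pmf.expectation (Pi_pmf W {} (\<lambda>_. ?R))
      (\<lambda>g. measure_pmf.expectation (Pi_pmf ?V {} (\<lambda>_. ?R)) (\<lambda>f. \<Prod>j\<in>?V. ?h g (f j)))"
    unfolding union using finPi finW by (simp add: expectation_pair_pmf case_prod_beta')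
  also have "\<dots> = measure_pmf.expectation (Pi_pmf W {} (\<lambda>_. ?R))
      (\<lambda>g. \<Prod>j\<in>?V. measure_pmf.expectation ?R (?h g))"
    using assms(4) finR
    by (intro Bochner_Integration.integral_cong refl expectation_prod_Pi_pmf)
       (auto intro!: prod_nonneg integrable_measure_pmf_finite)
  also have "\<dots> = measure_pmf.expectation (Pi_pmf W {} (\<lambda>_. ?R))
      (\<lambda>g. measure_pmf.expectation ?R (?h g) ^ (n - card W))"
    using finW assms(1) by (simp add: card_Diff_subset)
  finally show ?thesis .
qed

text \<open>The inner expectation does not depend on the ring of \<open>i\<close>, since all rings have the same size.\<close>

lemma prob_cut_off_singleton:
  assumes "i \<in> {1..n}" "K \<le> P" "0 \<le> \<alpha>" "\<alpha> \<le> 1"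
  shows "measure_pmf.prob (key_channel_pmf n K P \<alpha>) (cut_off n {i}) =
           (1 - \<alpha> * (1 - q K P)) ^ (n - 1)"
proof -
  let ?R = "pmf_of_set (key_rings K P)"
  have finR: "finite (set_pmf ?R)"
    using assms(2) by (simp add: set_pmf_key_rings finite_key_rings)
  have one: "measure_pmf.expectation ?R (\<lambda>T. if S \<inter> T = {} then 1 else 1 - \<alpha>) =
      1 - \<alpha> * (1 - q K P)" if "S \<in> key_rings K P" for S
  proof -
    have "measure_pmf.expectation ?R (\<lambda>T. if S \<inter> T = {} then 1 else 1 - \<alpha>) =
        measure_pmf.expectation ?R (\<lambda>T. (1 - \<alpha>) + \<alpha> * indicator {T. S \<inter> T = {}} T)"
      by (intro Bochner_Integration.integral_cong) auto
    also have "\<dots> = (1 - \<alpha>) + \<alpha> * q K P"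
      using finR prob_key_ring_avoids_ring[OF assms(2) that]
      by (subst Bochner_Integration.integral_add) (auto intro: integrable_measure_pmf_finite)
    finally show ?thesis by (simp add: algebra_simps)
  qed
  have "measure_pmf.prob (key_channel_pmf n K P \<alpha>) (cut_off n {i}) =
      measure_pmf.expectation ?R (\<lambda>S. measure_pmf.expectation ?R
        (\<lambda>T. if S \<inter> T = {} then 1 else 1 - \<alpha>) ^ (n - 1))"
    using assms by (subst prob_cut_off) (auto simp: Pi_pmf_singleton)
  also have "\<dots> = measure_pmf.expectation ?R (\<lambda>S. (1 - \<alpha> * (1 - q K P)) ^ (n - 1))"
    using assms(2) one
    by (intro integral_cong_AE) (auto simp: AE_measure_pmf_iff set_pmf_key_rings)
  finally show ?thesis by simp
qed

text \<open>Each factor is \<open>(1 - \<alpha>) + \<alpha> I\<close>, with \<open>I\<close> the indicator of avoiding the respective ring. The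
  first summand on the right is the value under independence, the second the covariance.\<close>

lemma expectation_avoid_two_rings:
  assumes "S \<in> key_rings K P" "S' \<in> key_rings K P" "K \<le> P"
  shows "measure_pmf.expectation (pmf_of_set (key_rings K P))
      (\<lambda>T. (if S \<inter> T = {} then 1 else 1 - \<alpha>) * (if S' \<inter> T = {} then 1 else 1 - \<alpha>)) =
    (1 - \<alpha> * (1 - q K P))\<^sup>2 + \<alpha>\<^sup>2 *
      (measure_pmf.prob (pmf_of_set (key_rings K P)) {T. (S \<union> S') \<inter> T = {}} - (q K P)\<^sup>2)"
    (is "?E = _ + _ * (?r - _)")
proof -
  let ?R = "pmf_of_set (key_rings K P)"
  have finR: "finite (set_pmf ?R)"
    using assms(3) by (simp add: set_pmf_key_rings finite_key_rings)
  have int: "integrable ?R f" for f :: "nat set \<Rightarrow> real"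
    using finR by (rule integrable_measure_pmf_finite)
  have "?E = measure_pmf.expectation ?R (\<lambda>T. (1 - \<alpha>)\<^sup>2
      + \<alpha> * (1 - \<alpha>) * indicator {T. S \<inter> T = {}} T + \<alpha> * (1 - \<alpha>) * indicator {T. S' \<inter> T = {}} T
      + \<alpha>\<^sup>2 * indicator {T. (S \<union> S') \<inter> T = {}} T)"
    by (intro Bochner_Integration.integral_cong)
       (auto simp: indicator_def Int_Un_distrib2 power2_eq_square algebra_simps)
  also have "\<dots> = (1 - \<alpha>)\<^sup>2 + \<alpha> * (1 - \<alpha>) * q K P + \<alpha> * (1 - \<alpha>) * q K P + \<alpha>\<^sup>2 * ?r"
    using prob_key_ring_avoids_ring[OF assms(3)] assms(1,2)
    by (simp add: int)
  finally show ?thesis by (simp add: power2_eq_square algebra_simps)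
qed

text \<open>The two summands correspond to the rings of \<open>i\<close> and \<open>j\<close> being disjoint, which has probability
  \<open>q K P\<close>, or not. In the first case the covariance is nonpositive; in the second it is at most
  \<open>\<alpha>\<^sup>2 q (1 - q) = q \<alpha> p \<le> \<alpha> p\<close>.\<close>

lemma prob_cut_off_pair_le:
  assumes "i \<in> {1..n}" "j \<in> {1..n}" "i \<noteq> j" "K \<le> P" "0 \<le> \<alpha>" "\<alpha> \<le> 1"
  defines "p \<equiv> \<alpha> * (1 - q K P)"
  shows "measure_pmf.prob (key_channel_pmf n K P \<alpha>) (cut_off n {i, j}) \<le>
           q K P * ((1 - p)\<^sup>2) ^ (n - 2) + (1 - q K P) * ((1 - p)\<^sup>2 + \<alpha> * p) ^ (n - 2)"
proof -
  let ?R = "pmf_of_set (key_rings K P)"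
  let ?s = "(1 - p)\<^sup>2" and ?m = "n - 2"
  let ?E = "\<lambda>S S'. measure_pmf.expectation ?R
     (\<lambda>T. (if S \<inter> T = {} then 1 else 1 - \<alpha>) * (if S' \<inter> T = {} then 1 else 1 - \<alpha>))"
  have finR: "finite (set_pmf ?R)"
    using assms(4) by (simp add: set_pmf_key_rings finite_key_rings)
  have int: "integrable ?R f" for f :: "nat set \<Rightarrow> real"
    using finR by (rule integrable_measure_pmf_finite)
  have q01: "0 \<le> q K P" "q K P \<le> 1" using q_nonneg q_le_1 assms(4) by auto
  have E_nonneg: "0 \<le> ?E S S'" for S S'
    using assms(6) by (intro Bochner_Integration.integral_nonneg) auto
  have E_le: "?E S S' ^ ?m \<le>
      (?s + \<alpha> * p) ^ ?m - ((?s + \<alpha> * p) ^ ?m - ?s ^ ?m) * indicator {T. S \<inter> T = {}} S'"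
    if S: "S \<in> key_rings K P" "S' \<in> key_rings K P" for S S'
  proof (cases "S \<inter> S' = {}")
    case True
    have "?E S S' \<le> ?s"
      unfolding expectation_avoid_two_rings[OF S assms(4)] p_def
      using prob_key_ring_avoids_disjoint_pair[OF assms(4) S True] by (simp add: mult_nonneg_nonpos)
    with True show ?thesis using E_nonneg[of S S'] by (simp add: power_mono)
  next
    case False
    have "measure_pmf.prob ?R {T. (S \<union> S') \<inter> T = {}} \<le> measure_pmf.prob ?R {T. S \<inter> T = {}}"
      by (intro measure_pmf.finite_measure_mono) auto
    then have r: "measure_pmf.prob ?R {T. (S \<union> S') \<inter> T = {}} \<le> q K P"
      using prob_key_ring_avoids_ring[OF assms(4) S(1)] by simp
    have "\<alpha>\<^sup>2 * (measure_pmf.prob ?R {T. (S \<union> S') \<inter> T = {}} - (q K P)\<^sup>2) \<le> \<alpha>\<^sup>2 * (q K P - (q K P)\<^sup>2)"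
      using r by (intro mult_left_mono) auto
    also have "\<dots> = q K P * (\<alpha> * p)"
      by (simp add: p_def power2_eq_square algebra_simps)
    also have "\<dots> \<le> \<alpha> * p"
      using q01 assms(5) by (intro mult_left_le_one_le) (auto simp: p_def)
    finally have "?E S S' \<le> ?s + \<alpha> * p"
      unfolding expectation_avoid_two_rings[OF S assms(4)] p_def by simp
    with False show ?thesis using E_nonneg[of S S'] by (simp add: power_mono)
  qed
  have pair: "Pi_pmf {i, j} {} (\<lambda>_. ?R) =
      map_pmf (\<lambda>(S, S'). (\<lambda>_. {})(j := S', i := S)) (pair_pmf ?R ?R)"
  proof -
    have "Pi_pmf {j} {} (\<lambda>_. ?R) = map_pmf (\<lambda>S'. (\<lambda>_. {})(j := S')) ?R"
      by (auto simp: Pi_pmf_singleton fun_upd_def intro!: map_pmf_cong)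
    then show ?thesis
      using assms(3) by (simp add: Pi_pmf_insert pair_map_pmf2 map_pmf_comp case_prod_beta')
  qed
  have "measure_pmf.prob (key_channel_pmf n K P \<alpha>) (cut_off n {i, j}) =
      measure_pmf.expectation ?R (\<lambda>S. measure_pmf.expectation ?R (\<lambda>S'. ?E S S' ^ ?m))"
    using assms finR
    by (subst prob_cut_off) (auto simp: pair expectation_pair_pmf case_prod_beta' numeral_2_eq_2)
  also have "\<dots> \<le> measure_pmf.expectation ?R (\<lambda>S.
      q K P * ?s ^ ?m + (1 - q K P) * (?s + \<alpha> * p) ^ ?m)"
  proof (intro integral_mono_AE int)
    show "AE S in ?R. measure_pmf.expectation ?R (\<lambda>S'. ?E S S' ^ ?m) \<le>
        q K P * ?s ^ ?m + (1 - q K P) * (?s + \<alpha> * p) ^ ?m"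
      unfolding AE_measure_pmf_iff set_pmf_key_rings[OF assms(4)]
    proof
      fix S assume S: "S \<in> key_rings K P"
      have "measure_pmf.expectation ?R (\<lambda>S'. ?E S S' ^ ?m) \<le> measure_pmf.expectation ?R (\<lambda>S'.
          (?s + \<alpha> * p) ^ ?m - ((?s + \<alpha> * p) ^ ?m - ?s ^ ?m) * indicator {T. S \<inter> T = {}} S')"
        by (intro integral_mono_AE int)
           (auto simp: AE_measure_pmf_iff set_pmf_key_rings[OF assms(4)] intro!: E_le[OF S])
      also have "\<dots> = (?s + \<alpha> * p) ^ ?m - ((?s + \<alpha> * p) ^ ?m - ?s ^ ?m) * q K P"
        using prob_key_ring_avoids_ring[OF assms(4) S] by (simp add: int)
      finally show "measure_pmf.expectation ?R (\<lambda>S'. ?E S S' ^ ?m) \<le>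
          q K P * ?s ^ ?m + (1 - q K P) * (?s + \<alpha> * p) ^ ?m"
        by (simp add: algebra_simps)
    qed
  qed
  finally show ?thesis by simp
qed

section \<open>The second moment bound\<close>

text \<open>With \<open>X\<close> the number of events that occur and \<open>\<mu>\<close> its mean, this is Chebyshev's inequality
  \<open>prob (X = 0) \<le> E (X\<^sup>2) / \<mu>\<^sup>2 - 1\<close>. It follows from the pointwise bound of the indicator of
  \<open>X = 0\<close> by \<open>(X / \<mu> - 1)\<^sup>2\<close>.\<close>

lemma (in prob_space) prob_no_event_le:
  assumes "finite I" "I \<noteq> {}" "\<And>i. i \<in> I \<Longrightarrow> E i \<in> events"
    and a: "0 < a" "\<And>i. i \<in> I \<Longrightarrow> prob (E i) = a"
    and b: "0 \<le> b" "\<And>i j. i \<in> I \<Longrightarrow> j \<in> I \<Longrightarrow> i \<noteq> j \<Longrightarrow> prob (E i \<inter> E j) \<le> b"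
  shows "prob {\<omega> \<in> space M. \<forall>i\<in>I. \<omega> \<notin> E i} \<le> 1 / (real (card I) * a) + b / a\<^sup>2 - 1"
proof -
  let ?n = "real (card I)"
  let ?N = "{\<omega> \<in> space M. \<forall>i\<in>I. \<omega> \<notin> E i}"
  let ?X = "\<lambda>\<omega>. \<Sum>i\<in>I. indicator (E i) \<omega> :: real"
  have n: "?n > 0" using assms(1,2) by (simp add: card_gt_0_iff)
  have "?N = space M - (\<Union>i\<in>I. E i)" by auto
  then have N: "?N \<in> events" using assms(1,3) by (metis sets.Diff sets.top sets.finite_UN)
  have sq: "(?X \<omega>)\<^sup>2 = (\<Sum>i\<in>I. \<Sum>j\<in>I. indicator (E i \<inter> E j) \<omega>)" for \<omega>
    by (simp add: power2_eq_square sum_product indicator_inter_arith)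
  have int1: "integrable M (\<lambda>\<omega>. indicator (E i) \<omega> :: real)" if "i \<in> I" for i
    using assms(3) that by (simp add: less_top[symmetric])
  have int2: "integrable M (\<lambda>\<omega>. indicator (E i \<inter> E j) \<omega> :: real)" if "i \<in> I" "j \<in> I" for i j
    using assms(3) that sets.Int by (simp add: less_top[symmetric])
  have intX: "integrable M ?X" using int1 by (intro Bochner_Integration.integrable_sum)
  have intXX: "integrable M (\<lambda>\<omega>. (?X \<omega>)\<^sup>2)"
    unfolding sq using int2 by (intro Bochner_Integration.integrable_sum)
  have EX: "expectation ?X = ?n * a"
    using int1 a(2) assms(3) sets.sets_into_space
    by (subst Bochner_Integration.integral_sum) (auto simp: Int_absorb2)
  have "expectation (\<lambda>\<omega>. (?X \<omega>)\<^sup>2) = (\<Sum>i\<in>I. \<Sum>j\<in>I. expectation (indicator (E i \<inter> E j)))"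
    unfolding sq using int2
    by (simp add: Bochner_Integration.integral_sum Bochner_Integration.integrable_sum)
  also have "\<dots> = (\<Sum>i\<in>I. \<Sum>j\<in>I. prob (E i \<inter> E j))"
    using assms(3)[THEN sets.sets_into_space] by (intro sum.cong refl) (auto intro!: arg_cong[of _ _ prob])
  also have "\<dots> \<le> (\<Sum>i\<in>I. \<Sum>j\<in>I. (if j = i then a else 0) + b)"
    using a b by (intro sum_mono) auto
  also have "\<dots> = ?n * a + ?n\<^sup>2 * b"
    using assms(1) by (simp add: sum.distrib power2_eq_square algebra_simps)
  finally have EXX: "expectation (\<lambda>\<omega>. (?X \<omega>)\<^sup>2) \<le> ?n * a + ?n\<^sup>2 * b" .
  have "prob ?N = expectation (indicator ?N)"
    using N by simp
  also have "\<dots> \<le> expectation (\<lambda>\<omega>. (?X \<omega>)\<^sup>2 / (?n * a)\<^sup>2 - 2 * ?X \<omega> / (?n * a) + 1)"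
  proof (rule integral_mono)
    fix \<omega>
    have "(?X \<omega>)\<^sup>2 / (?n * a)\<^sup>2 - 2 * ?X \<omega> / (?n * a) + 1 = (?X \<omega> / (?n * a) - 1)\<^sup>2"
      by (simp add: power2_diff power_divide)
    moreover have "indicator ?N \<omega> \<le> (?X \<omega> / (?n * a) - 1)\<^sup>2"
      by (auto simp: indicator_def)
    ultimately show "indicator ?N \<omega> \<le> (?X \<omega>)\<^sup>2 / (?n * a)\<^sup>2 - 2 * ?X \<omega> / (?n * a) + 1"
      by simp
  qed (use N intX intXX in \<open>auto simp: less_top[symmetric] simp del: sum_indicator_eq_card\<close>)
  also have "\<dots> = expectation (\<lambda>\<omega>. (?X \<omega>)\<^sup>2) / (?n * a)\<^sup>2 - 2 * expectation ?X / (?n * a) + 1"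
    using intX intXX by (simp add: prob_space)
  also have "\<dots> \<le> (?n * a + ?n\<^sup>2 * b) / (?n * a)\<^sup>2 - 2 + 1"
    using EXX n a by (intro add_mono diff_mono divide_right_mono) (auto simp: EX)
  also have "\<dots> = 1 / (?n * a) + b / a\<^sup>2 - 1"
    using n a(1) by (simp add: field_simps power2_eq_square)
  finally show ?thesis .
qed

text \<open>Here \<open>a\<^sup>2 = (1 - p)\<^sup>2 ^ (n - 1)\<close>, whereas only \<open>n - 2\<close> further nodes enter the pair probability;
  the division by \<open>(1 - p)\<^sup>2\<close> in the second summand is this leftover factor.\<close>

lemma prob_no_isolated_le:
  assumes "2 \<le> n" "K \<le> P" "0 \<le> \<alpha>" "\<alpha> \<le> 1"
  defines "p \<equiv> \<alpha> * (1 - q K P)"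
  assumes "p < 1"
  shows "prob_no_isolated n K P \<alpha> \<le> 1 / (real n * (1 - p) ^ (n - 1)) +
     (1 + (1 - q K P) * ((1 + \<alpha> * p / (1 - p)\<^sup>2) ^ (n - 2) - 1)) / (1 - p)\<^sup>2 - 1"
proof -
  let ?M = "key_channel_pmf n K P \<alpha>"
  let ?s = "(1 - p)\<^sup>2" and ?m = "n - 2"
  let ?b = "q K P * ?s ^ ?m + (1 - q K P) * (?s + \<alpha> * p) ^ ?m"
  have q01: "0 \<le> q K P" "q K P \<le> 1" using q_nonneg q_le_1 assms(2) by auto
  have p0: "0 \<le> p" using q01 assms(3) by (simp add: p_def)
  have s: "0 < ?s" using assms(6) by simp
  have "{\<omega>. \<not> (\<exists>i. isolated_node n \<omega> i)} = {\<omega> \<in> space ?M. \<forall>i\<in>{1..n}. \<omega> \<notin> cut_off n {i}}"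
    unfolding isolated_node_iff_cut_off by auto
  then have "prob_no_isolated n K P \<alpha> =
      measure_pmf.prob ?M {\<omega> \<in> space ?M. \<forall>i\<in>{1..n}. \<omega> \<notin> cut_off n {i}}"
    by (simp add: prob_no_isolated_def)
  also have "\<dots> \<le> 1 / (real (card {1..n}) * (1 - p) ^ (n - 1)) + ?b / ((1 - p) ^ (n - 1))\<^sup>2 - 1"
  proof (rule measure_pmf.prob_no_event_le)
    fix i j assume ij: "i \<in> {1..n}" "j \<in> {1..n}" "i \<noteq> j"
    have "measure_pmf.prob ?M (cut_off n {i} \<inter> cut_off n {j}) \<le> measure_pmf.prob ?M (cut_off n {i, j})"
      by (intro measure_pmf.finite_measure_mono) (auto simp: cut_off_def)
    also have "\<dots> \<le> ?b"
      using prob_cut_off_pair_le[OF ij assms(2,3,4)] by (simp add: p_def)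
    finally show "measure_pmf.prob ?M (cut_off n {i} \<inter> cut_off n {j}) \<le> ?b" .
  qed (use assms q01 p0 prob_cut_off_singleton[OF _ assms(2,3,4)] in auto)
  also have "?b / ((1 - p) ^ (n - 1))\<^sup>2 =
      (1 + (1 - q K P) * ((1 + \<alpha> * p / ?s) ^ ?m - 1)) / ?s"
  proof -
    have "((1 - p) ^ (n - 1))\<^sup>2 = ?s ^ (n - 1)"
      by (simp add: power_mult[symmetric] mult.commute)
    also have "\<dots> = ?s ^ ?m * ?s"
      using assms(1) by (metis Suc_diff_Suc Suc_1 Suc_le_eq power_Suc2)
    finally have pw: "((1 - p) ^ (n - 1))\<^sup>2 = ?s ^ ?m * ?s" .
    have "?s + \<alpha> * p = ?s * (1 + \<alpha> * p / ?s)"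
      using s by (simp add: distrib_left)
    then have "(?s + \<alpha> * p) ^ ?m = ?s ^ ?m * (1 + \<alpha> * p / ?s) ^ ?m"
      by (metis power_mult_distrib)
    then have "?b = ?s ^ ?m * (1 + (1 - q K P) * ((1 + \<alpha> * p / ?s) ^ ?m - 1))"
      by (simp add: algebra_simps)
    then show ?thesis using s unfolding pw by simp
  qed
  finally show ?thesis by simp
qed

section \<open>Asymptotics\<close>

text \<open>Both steps use \<open>1 + t \<le> exp t\<close>: with \<open>t = x\<close> it gives \<open>(1 + x) ^ m \<le> exp (m x)\<close>, and with
  \<open>t = - m x\<close> it gives \<open>exp y - 1 \<le> y exp y\<close> for \<open>y = m x\<close>.\<close>

lemma compound_growth_le:
  fixes x :: real
  assumes "0 \<le> x"
  shows "(1 + x) ^ m - 1 \<le> real m * x * exp (real m * x)"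
proof -
  have "(1 + x) ^ m \<le> exp x ^ m"
    using assms by (intro power_mono) auto
  then have "(1 + x) ^ m \<le> exp (real m * x)"
    by (simp add: exp_of_nat_mult)
  moreover have "(1 - real m * x) * exp (real m * x) \<le> exp (- (real m * x)) * exp (real m * x)"
    using exp_ge_add_one_self[of "- (real m * x)"] by (intro mult_right_mono) auto
  ultimately show ?thesis by (simp add: exp_minus algebra_simps)
qed

text \<open>The variable \<open>x\<close> stands for \<open>1 - q\<close> and \<open>s\<close> for \<open>(1 - p)\<^sup>2\<close>. The factor \<open>x\<close> in front is essential:
  together with \<open>\<alpha>\<close> it produces a second factor \<open>p\<close>, hence the gain \<open>(log n)\<^sup>2 / n\<close>, which beats the
  exponential \<open>n powr (\<alpha> / s)\<close> because \<open>\<alpha> / s\<close> stays below \<open>1\<close>.\<close>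

lemma correlation_term_le:
  fixes n :: nat
  assumes n: "2 \<le> n" and \<alpha>: "0 \<le> \<alpha>" "\<alpha> \<le> 1 - \<delta>" and \<delta>: "0 < \<delta>" "\<delta> \<le> 1"
    and x: "0 \<le> x" "x \<le> 1" and p: "p = \<alpha> * x" "real n * p \<le> ln (real n)"
    and s: "1 - \<delta> / 2 \<le> s"
  shows "x * ((1 + \<alpha> * p / s) ^ (n - 2) - 1) \<le> 2 * (ln (real n))\<^sup>2 * real n powr (- \<delta> / 2)"
proof -
  let ?L = "ln (real n)"
  have s0: "1 / 2 \<le> s" using s \<delta> by simp
  have p0: "0 \<le> p" using p(1) x \<alpha> by simp
  let ?y = "\<alpha> * p / s"
  have y0: "0 \<le> ?y" using \<alpha> p0 s0 by simp
  \<comment> \<open>The margin \<open>\<delta>\<close> is split evenly between the loss in \<open>s\<close> and the exponent of \<open>n\<close>.\<close>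
  have "(1 - \<delta>) \<le> (1 - \<delta> / 2) * (1 - \<delta> / 2)" by (simp add: algebra_simps)
  also have "\<dots> \<le> (1 - \<delta> / 2) * s" using s \<delta> by (intro mult_left_mono) auto
  finally have as: "\<alpha> / s \<le> 1 - \<delta> / 2" using s0 \<alpha> by (simp add: field_simps)
  have "real (n - 2) * ?y \<le> real n * ?y" using y0 by (intro mult_right_mono) auto
  also have "\<dots> = \<alpha> / s * (real n * p)" by simp
  also have "\<dots> \<le> (1 - \<delta> / 2) * ?L"
    using as p(2) \<alpha> s0 \<delta> p0 by (intro mult_mono) auto
  finally have exponent: "real (n - 2) * ?y \<le> (1 - \<delta> / 2) * ?L" .
  have "x * (real (n - 2) * ?y) \<le> x * (real n * ?y)"
    using y0 x by (intro mult_left_mono mult_right_mono) auto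
  also have "\<dots> = (real n * p)\<^sup>2 / (real n * s)"
    using n s0 by (simp add: p(1) power2_eq_square field_simps)
  also have "\<dots> \<le> ?L\<^sup>2 / (real n * (1 / 2))"
    using p(2) p0 n s0 by (intro frac_le power_mono mult_left_mono) auto
  finally have factor: "x * (real (n - 2) * ?y) \<le> 2 * ?L\<^sup>2 / real n" by (simp add: mult.commute)
  have "x * ((1 + ?y) ^ (n - 2) - 1) \<le> x * (real (n - 2) * ?y * exp (real (n - 2) * ?y))"
    using compound_growth_le[OF y0] x by (intro mult_left_mono) auto
  also have "\<dots> = x * (real (n - 2) * ?y) * exp (real (n - 2) * ?y)" by simp
  also have "\<dots> \<le> 2 * ?L\<^sup>2 / real n * exp ((1 - \<delta> / 2) * ?L)"
    using factor exponent by (intro mult_mono) auto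
  also have "\<dots> = 2 * ?L\<^sup>2 * real n powr (- \<delta> / 2)"
  proof -
    have "(1 - \<delta> / 2) * ?L = ?L + - \<delta> / 2 * ?L" by (simp add: algebra_simps)
    then have "exp ((1 - \<delta> / 2) * ?L) = exp ?L * exp (- \<delta> / 2 * ?L)"
      by (simp only: exp_add)
    also have "\<dots> = real n * real n powr (- \<delta> / 2)"
      using n by (simp only: powr_def) simp
    finally show ?thesis using n by simp
  qed
  finally show ?thesis .
qed

text \<open>By \<open>ln (1 - p) \<ge> - p - 2 p\<^sup>2\<close>, the logarithm of \<open>n (1 - p) ^ n\<close> is at least
  \<open>ln n - n p - 2 n p\<^sup>2 \<ge> - g - 2\<close>.\<close>

lemma inverse_mean_le:
  fixes n :: nat and p g :: real
  assumes "1 \<le> n" "0 \<le> p" "p \<le> 1 / 2" "real n * p\<^sup>2 \<le> 1" "real n * p = ln (real n) + g"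
  shows "1 / (real n * (1 - p) ^ (n - 1)) \<le> exp (g + 2)"
proof -
  have "- p - 2 * p\<^sup>2 \<le> ln (1 - p)"
    using ln_one_minus_pos_lower_bound[of p] assms by simp
  then have "real n * (- p - 2 * p\<^sup>2) \<le> real n * ln (1 - p)"
    by (intro mult_left_mono) auto
  moreover have "real n * (- p - 2 * p\<^sup>2) = - ln (real n) - g - 2 * (real n * p\<^sup>2)"
    using assms(5) by (simp add: algebra_simps)
  ultimately have "- g - 2 \<le> ln (real n) + real n * ln (1 - p)"
    using assms(4) by linarith
  then have "exp (- g - 2) \<le> exp (ln (real n) + real n * ln (1 - p))" by simp
  also have "\<dots> = real n * (1 - p) ^ n"
    using assms by (simp add: exp_add exp_of_nat_mult)
  also have "\<dots> \<le> real n * (1 - p) ^ (n - 1)"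
    using assms by (intro mult_left_mono power_decreasing) auto
  finally have "exp (- g - 2) \<le> real n * (1 - p) ^ (n - 1)" .
  then have "1 / (real n * (1 - p) ^ (n - 1)) \<le> 1 / exp (- g - 2)"
    using assms(1,3) by (intro divide_left_mono mult_pos_pos zero_less_power) auto
  also have "\<dots> = exp (g + 2)"
    by (simp add: exp_minus[symmetric] inverse_eq_divide[symmetric])
  finally show ?thesis .
qed

lemma eventually_bounded_away_from_1:
  fixes \<alpha> :: "nat \<Rightarrow> real"
  assumes "limsup (\<lambda>n. ereal (\<alpha> n * ln (real n))) < \<infinity> \<or> limsup (\<lambda>n. ereal (\<alpha> n)) < 1"
  obtains \<delta> where "0 < \<delta>" "\<delta> \<le> 1" "\<forall>\<^sub>F n in sequentially. \<alpha> n \<le> 1 - \<delta>"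
  using assms
proof (elim disjE)
  assume "limsup (\<lambda>n. ereal (\<alpha> n * ln (real n))) < \<infinity>"
  then obtain C where "limsup (\<lambda>n. ereal (\<alpha> n * ln (real n))) < ereal C"
    using ereal_dense2 by blast
  from Limsup_lessD[OF this] have "\<forall>\<^sub>F n in sequentially. \<alpha> n * ln (real n) < C" by simp
  moreover have "\<forall>\<^sub>F n in sequentially. C / ln (real n) < 1 / 2" by real_asymp
  moreover have "\<forall>\<^sub>F n in sequentially. 0 < ln (real n)" by real_asymp
  ultimately have "\<forall>\<^sub>F n in sequentially. \<alpha> n \<le> 1 - 1 / 2"
  proof eventually_elim
    case (elim n)
    have "C < 1 / 2 * ln (real n)" using elim(2,3) by (simp only: pos_divide_less_eq)
    then have "\<alpha> n * ln (real n) < 1 / 2 * ln (real n)" using elim(1) by linarith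
    then have "\<alpha> n < 1 / 2" using elim(3) by (simp only: mult_less_cancel_right_pos)
    then show ?case by simp
  qed
  then show thesis by (intro that[of "1 / 2"]) auto
next
  assume "limsup (\<lambda>n. ereal (\<alpha> n)) < 1"
  then obtain c where c: "limsup (\<lambda>n. ereal (\<alpha> n)) < ereal c" "ereal c < 1"
    using ereal_dense2 by blast
  from Limsup_lessD[OF c(1)] have "\<forall>\<^sub>F n in sequentially. \<alpha> n < c" by simp
  then have "\<forall>\<^sub>F n in sequentially. \<alpha> n \<le> 1 - min 1 (1 - c)"
    by eventually_elim auto
  then show thesis using c(2) by (intro that[of "min 1 (1 - c)"]) auto
qed

theorem mainTheorem2:
  fixes K P :: "nat \<Rightarrow> nat" and \<alpha> \<gamma> :: "nat \<Rightarrow> real"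
  assumes "\<And>n. n \<ge> 1 \<Longrightarrow> 0 < K n \<and> K n < P n"
    and "\<And>n. n \<ge> 1 \<Longrightarrow> 0 \<le> \<alpha> n \<and> \<alpha> n \<le> 1"
    and "\<And>n. n \<ge> 1 \<Longrightarrow> \<alpha> n * (1 - q (K n) (P n)) = (ln (real n) + \<gamma> n) / real n"
    and "filterlim \<gamma> at_bot sequentially"
    and "limsup (\<lambda>n. ereal (\<alpha> n * ln (real n))) < \<infinity>
         \<or> (limsup (\<lambda>n. ereal (\<alpha> n * ln (real n))) = \<infinity> \<and> limsup (\<lambda>n. ereal (\<alpha> n)) < 1)"
  shows "(\<lambda>n. prob_no_isolated n (K n) (P n) (\<alpha> n)) \<longlonglongrightarrow> 0"
proof -
  obtain \<delta> where \<delta>: "0 < \<delta>" "\<delta> \<le> 1" and \<alpha>: "\<forall>\<^sub>F n in sequentially. \<alpha> n \<le> 1 - \<delta>"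
    using eventually_bounded_away_from_1 assms(5) by blast
  define L where "L = (\<lambda>n. ln (real n))"
  \<comment> \<open>\<open>U\<close> collects the bounds for the two parts of \<open>prob_no_isolated_le\<close>, with \<open>p\<close> replaced by its
    upper bound \<open>L n / real n\<close>.\<close>
  define U where "U = (\<lambda>n. exp (\<gamma> n + 2) +
    ((1 + 2 * (L n)\<^sup>2 * real n powr (- \<delta> / 2)) / (1 - L n / real n)\<^sup>2 - 1))"
  have "(\<lambda>n. exp (\<gamma> n + 2)) \<longlonglongrightarrow> 0"
  proof (rule filterlim_compose[OF exp_at_bot])
    show "filterlim (\<lambda>n. \<gamma> n + 2) at_bot sequentially"
    proof (rule filterlim_compose[OF _ assms(4)])
      show "filterlim (\<lambda>x::real. x + 2) at_bot at_bot" by real_asymp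
    qed
  qed
  moreover have "(\<lambda>n. (1 + 2 * (L n)\<^sup>2 * real n powr (- \<delta> / 2)) / (1 - L n / real n)\<^sup>2 - 1) \<longlonglongrightarrow> 0"
    unfolding L_def using \<delta>(1) by real_asymp
  ultimately have U_lim: "U \<longlonglongrightarrow> 0"
    unfolding U_def using tendsto_add[of _ "0::real" _ _ "0::real"] by simp
  have ev1: "\<forall>\<^sub>F n in sequentially. L n / real n \<le> 1 / 2"
    unfolding L_def by real_asymp
  have ev2: "\<forall>\<^sub>F n in sequentially. (L n)\<^sup>2 / real n \<le> 1"
    unfolding L_def by real_asymp
  have ev3: "\<forall>\<^sub>F n in sequentially. 1 - \<delta> / 2 \<le> (1 - L n / real n)\<^sup>2"
    unfolding L_def using \<delta>(1) by real_asymp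
  have ev4: "\<forall>\<^sub>F n in sequentially. \<gamma> n \<le> 0"
    using assms(4) by (simp add: filterlim_at_bot)
  have "\<forall>\<^sub>F n in sequentially. prob_no_isolated n (K n) (P n) (\<alpha> n) \<le> U n"
    using ev1 ev2 ev3 ev4 \<alpha> eventually_ge_at_top[of "2::nat"]
  proof eventually_elim
    case (elim n)
    define x where "x = 1 - q (K n) (P n)"
    define p where "p = \<alpha> n * x"
    have n: "1 \<le> n" and KP: "K n \<le> P n" and a01: "0 \<le> \<alpha> n" "\<alpha> n \<le> 1"
      using assms(1)[of n] assms(2)[of n] elim(6) by auto
    have x01: "0 \<le> x" "x \<le> 1" using q_nonneg q_le_1[OF KP] by (auto simp: x_def)
    have p0: "0 \<le> p" using a01 x01 by (simp add: p_def)
    have np: "real n * p = L n + \<gamma> n"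
      using assms(3)[OF n] n by (simp add: p_def x_def L_def)
    have npL: "real n * p \<le> L n" using np elim(4) by simp
    then have pL: "p \<le> L n / real n" using n by (simp add: field_simps)
    have p_half: "p \<le> 1 / 2" using pL elim(1) by (rule order_trans)
    have "real n * p\<^sup>2 = (real n * p)\<^sup>2 / real n" using n by (simp add: power2_eq_square)
    also have "\<dots> \<le> (L n)\<^sup>2 / real n"
      using npL p0 by (intro divide_right_mono power_mono) auto
    finally have np2: "real n * p\<^sup>2 \<le> 1" using elim(2) by simp
    have s: "(1 - L n / real n)\<^sup>2 \<le> (1 - p)\<^sup>2"
      by (intro power_mono) (use pL elim(1) in linarith)+
    have spos: "0 < (1 - L n / real n)\<^sup>2" using elim(1) by (intro zero_less_power) linarith
    have "prob_no_isolated n (K n) (P n) (\<alpha> n) \<le> 1 / (real n * (1 - p) ^ (n - 1)) +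
        (1 + x * ((1 + \<alpha> n * p / (1 - p)\<^sup>2) ^ (n - 2) - 1)) / (1 - p)\<^sup>2 - 1"
      using prob_no_isolated_le[OF elim(6) KP a01] p_half by (simp add: p_def x_def)
    also have "1 / (real n * (1 - p) ^ (n - 1)) \<le> exp (\<gamma> n + 2)"
      using inverse_mean_le[OF n p0 p_half np2] np by (simp add: L_def)
    also have "(1 + x * ((1 + \<alpha> n * p / (1 - p)\<^sup>2) ^ (n - 2) - 1)) / (1 - p)\<^sup>2 \<le>
        (1 + 2 * (L n)\<^sup>2 * real n powr (- \<delta> / 2)) / (1 - L n / real n)\<^sup>2"
      using correlation_term_le[OF elim(6) a01(1) elim(5) \<delta> x01 p_def, of "(1 - p)\<^sup>2"]
        npL s spos elim(3)
      by (intro frac_le add_left_mono) (auto simp: L_def)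
    finally show ?case by (simp add: U_def)
  qed
  then show ?thesis
    by (intro tendsto_sandwich[OF _ _ tendsto_const U_lim]) (auto simp: prob_no_isolated_def)
qed

end
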